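(* Consider the GNEP with quasi-linear constraints in which player $i$ ($i=1,\ldots,N$) solves $\mathrm{F}_i(x_{-i}):\ \min_{x_i\in\mathbb{R}^{n_i}} f_i(x_i,x_{-i})$ s.t. $A_ix_i-b_i(x_{-i})\ge 0$. Assume the KKT set $\mathcal{K}$ is finite and $\Theta$ is a generic symmetric positive definite matrix. Then, after enumerating all $J\in\mathcal{P}$, Algorithm B (described in the context) finds all generalized Nash equilibria (GNEs) if its output set $\mathcal{S}\neq\emptyset$, or detects nonexistence of GNEs if $\mathcal{S}=\emptyset$.
   Context: **Setting.** There are $N$ players; player $i$'s strategy is $x_i\in\mathbb{R}^{n_i}$, $x=(x_1,\ldots,x_N)\in\mathbb{R}^n$ with $n=n_1+\cdots+n_N$, and $x_{-i}$ denotes $x$ with $x_i$ removed, so $x=(x_i,x_{-i})$. Each $f_i$ is a real polynomial in $x$, each $A_i\in\mathbb{R}^{m_i\times n_i}$ is a constant matrix, and $b_i(x_{-i})$ is a vector of $m_i$ real polynomials in $x_{-i}$. Write $[m]=\{1,\ldots,m\}$, $X_i(x_{-i})=\{x_i: A_ix_i-b_i(x_{-i})\ge0\}$ and $X=\{x: A_ix_i-b_i(x_{-i})\ge 0 \text{ for all } i\in[N]\}$. A GNE is a tuple $u=(u_1,\ldots,u_N)$ such that each $u_i$ is a global minimizer of $\mathrm{F}_i(u_{-i})$. For vectors $u,v$ of equal length, $0\le u\perp v\ge 0$ means $u,v\ge0$ entrywise and $u^Tv=0$. The KKT set is $$\mathcal{K}=\{x\in X:\ \exists\,\lambda_i\in\mathbb{R}^{m_i}\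 (i\in[N])\text{ such that for every }i:\ \nabla_{x_i}f_i(x)-A_i^T\lambda_i=0,\ 0\le\lambda_i\perp (A_ix_i-b_i(x_{-i}))\ge 0\}.$$ Let $r_i=\operatorname{rank}A_i$. For $J_i\subseteq[m_i]$, $A_{i,J_i}$, $b_{i,J_i}$ denote the parts of $A_i$, $b_i$ with rows labelled by $J_i$. Let $\mathcal{P}_i=\{J_i\subseteq[m_i]: |J_i|=r_i,\ \operatorname{rank}A_{i,J_i}=r_i\}$ and $\mathcal{P}=\mathcal{P}_1\times\cdots\times\mathcal{P}_N$. For $J_i\in\mathcal{P}_i$ let $\lambda_{i,J_i}(x)=(A_{i,J_i}A_{i,J_i}^T)^{-1}A_{i,J_i}\nabla_{x_i}f_i(x)$. For $J=(J_1,\ldots,J_N)\in\mathcal{P}$, $$\mathcal{K}_J=\{x\in X:\ \nabla_{x_i}f_i(x)-A_{i,J_i}^T\lambda_{i,J_i}(x)=0,\ 0\le\lambda_{i,J_i}(x)\perp(A_{i,J_i}x_i-b_{i,J_i}(x_{-i}))\ge0,\ \text{for all } i=1,\ldots,N\}.$$ For a symmetric positive definite $\Theta\in\mathbb{R}^{(n+1)\times(n+1)}$ put $\theta(x)=[x]_1^T\Theta[x]_1$, where $[x]_1=(1,x_1,\ldots,x_n)^T$ (here $x_1,\ldots,x_n$ are the $n$ scalar coordinates of $x$). A property is said to hold for generic $\Theta$ if it holds for all $\Theta$ in an open dense subset, in the Zariski topology, of the space of symmetric $(n+1)\times(n+1)$ matrices. **Algorithm A** (for a given $J\in\mathcal{P}$).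 Select a generic symmetric positive definite $\Theta$ and a small $\delta>0$ (say $0.5$). Set $\mathcal{S}_J:=\emptyset$, $j:=1$. All optimization problems are solved to global optimality. - Step 1: Solve $\min\{\theta(x): x\in\mathcal{K}_J\}$. If infeasible, output nonexistence of GNEs in $\mathcal{K}_J$ and stop. Otherwise let $u^{(1)}$ be a minimizer and go to Step 2. - Step 2: For each $i\in[N]$ compute the optimal value $\epsilon_i$ of $\min\{f_i(x_i,u_{-i})-f_i(u_i,u_{-i}): x_i\in X_i(u_{-i})\}$ with $u:=u^{(j)}$. If $\epsilon_i\ge0$ for every $i$, update $\mathcal{S}_J:=\mathcal{S}_J\cup\{u^{(j)}\}$. - Step 3: Compute $\theta_{\max}=\max\{\theta(x): x\in\mathcal{K}_J,\ \theta(x)\le\theta(u^{(j)})+\delta\}$. - Step 4: If $\theta_{\max}=\theta(u^{(j)})$, go to Step 5; otherwise set $\delta:=\delta/2$ and go to Step 3. - Step 5: Solve $\min\{\theta(x): x\in\mathcal{K}_J,\ \theta(x)\ge\theta(u^{(j)})+\delta\}$. If infeasible, output that $\mathcal{S}_J$ is the set of all GNEs in $\mathcal{K}_J$ and stop. Otherwise let $u^{(j+1)}$ be a minimizer, set $j:=j+1$ and go to Step 2. **Algorithm B.** Form $\mathcal{P}$ and set $\mathcal{S}:=\emptyset$. For each $J\in\mathcal{P}$: form the expressions $\lambda_{i,J_i}$ for each $i$; apply Algorithm A to find the set $\mathcal{S}_J$ of all GNEs in $\mathcal{K}_J$; update $\mathcal{S}:=\mathcal{S}\cup\mathcal{S}_J$.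 *)

theory Defs
  imports "HOL-Analysis.Analysis"
begin

text \<open>
  Blocks of varying size are encoded inside fixed finite index types.  For an index set \<open>I\<close>, the
  space \<open>\<real>\<^sup>I\<close> is the set of those vectors that vanish outside \<open>I\<close>, and the part of a matrix with rows
  in \<open>I\<close> and columns in \<open>K\<close> is the matrix that is zero outside \<open>I \<times> K\<close>.  Products, inner
  products and ranks of blocks are unaffected by this zero padding.
\<close>

definition coord_space :: "'a set \<Rightarrow> (real^'a) set" where
  "coord_space I = {v. \<forall>k. k \<notin> I \<longrightarrow> v $ k = 0}"

definition restr :: "'a set \<Rightarrow> real^'a \<Rightarrow> real^'a" where
  "restr I v = (\<chi> k. if k \<in> I then v $ k else 0)"

definition submat :: "'m set \<Rightarrow> 'n set \<Rightarrow> real^'n^'m \<Rightarrow> real^'n^'m" where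
  "submat I K A = (\<chi> r k. if r \<in> I \<and> k \<in> K then A $ r $ k else 0)"

text \<open>
  The inverse of a \<open>J \<times> J\<close> matrix: two-sided inverse among the matrices supported on \<open>J \<times> J\<close>,
  whose identity is \<open>submat J J (mat 1)\<close>.  Meaningful only if that block is invertible.
\<close>

definition block_inv :: "'m set \<Rightarrow> real^'m^'m \<Rightarrow> real^'m^'m" where
  "block_inv J B = (THE C. submat J J C = C \<and>
     B ** C = submat J J (mat 1) \<and> C ** B = submat J J (mat 1))"

definition perp_nonneg :: "real^'m \<Rightarrow> real^'m \<Rightarrow> bool" where
  "perp_nonneg u v \<longleftrightarrow> (\<forall>r. 0 \<le> u $ r) \<and> (\<forall>r. 0 \<le> v $ r) \<and> u \<bullet> v = 0"

definition gradient :: "(real^'n \<Rightarrow> real) \<Rightarrow> real^'n \<Rightarrow> real^'n" where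
  "gradient f x = (\<chi> k. frechet_derivative f (at x) (axis k 1))"


section \<open>Generalized Nash equilibrium problems with quasi-linear constraints\<close>

text \<open>
  Players are the elements of \<open>'p\<close>, and \<open>'n\<close> indexes all scalar coordinates of
  \<open>x = (x\<^sub>1, \<dots>, x\<^sub>N)\<close>; \<open>owner\<close> tells which player controls a coordinate, so player \<open>i\<close> has
  \<open>n\<^sub>i = card {k. owner G k = i}\<close> coordinates.  The constraints of player \<open>i\<close> are labelled by
  \<open>crows G i\<close> (playing the role of \<open>[m\<^sub>i]\<close>), possibly empty.  Entries of \<open>Amat G i\<close> outside
  \<open>crows G i \<times> {k. owner G k = i}\<close> and entries of \<open>bvec G i\<close> outside \<open>crows G i\<close> are never used, and
  \<open>bvec G i\<close> is only evaluated at \<open>x\<^sub>-\<^sub>i\<close> (zero padded).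
\<close>

record ('p, 'n::finite, 'm::finite) gnep =
  owner :: "'n \<Rightarrow> 'p"
  crows :: "'p \<Rightarrow> 'm set"
  Amat  :: "'p \<Rightarrow> real^'n^'m"
  bvec  :: "'p \<Rightarrow> real^'n \<Rightarrow> real^'m"
  obj   :: "'p \<Rightarrow> real^'n \<Rightarrow> real"

definition coords :: "('p, 'n::finite, 'm::finite) gnep \<Rightarrow> 'p \<Rightarrow> 'n set" where
  "coords G i = {k. owner G k = i}"

text \<open>\<open>x\<^sub>i\<close> and \<open>x\<^sub>-\<^sub>i\<close>; the tuple \<open>(v, x\<^sub>-\<^sub>i)\<close> with \<open>v\<close> in the space of player \<open>i\<close> is
  \<open>v + others G i x\<close>.\<close>

definition own :: "('p, 'n::finite, 'm::finite) gnep \<Rightarrow> 'p \<Rightarrow> real^'n \<Rightarrow> real^'n" where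
  "own G i x = restr (coords G i) x"

definition others :: "('p, 'n::finite, 'm::finite) gnep \<Rightarrow> 'p \<Rightarrow> real^'n \<Rightarrow> real^'n" where
  "others G i x = restr (- coords G i) x"

definition A_part :: "('p, 'n::finite, 'm::finite) gnep \<Rightarrow> 'p \<Rightarrow> 'm set \<Rightarrow> real^'n^'m" where
  "A_part G i J = submat J (coords G i) (Amat G i)"

definition b_part :: "('p, 'n::finite, 'm::finite) gnep \<Rightarrow> 'p \<Rightarrow> 'm set \<Rightarrow> real^'n \<Rightarrow> real^'m" where
  "b_part G i J w = restr J (bvec G i w)"

text \<open>\<open>A\<^bsub>i,J\<^esub> v - b\<^bsub>i,J\<^esub>(w)\<close> for \<open>v\<close> in the space of player \<open>i\<close> and \<open>w = x\<^sub>-\<^sub>i\<close>\<close>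

definition slack :: "('p, 'n::finite, 'm::finite) gnep \<Rightarrow> 'p \<Rightarrow> 'm set \<Rightarrow> real^'n \<Rightarrow> real^'n \<Rightarrow> real^'m" where
  "slack G i J v w = A_part G i J *v v - b_part G i J w"

definition feasible_i :: "('p, 'n::finite, 'm::finite) gnep \<Rightarrow> 'p \<Rightarrow> real^'n \<Rightarrow> (real^'n) set" where
  "feasible_i G i w = {v \<in> coord_space (coords G i). \<forall>r. 0 \<le> slack G i (crows G i) v w $ r}"

definition feasible :: "('p, 'n::finite, 'm::finite) gnep \<Rightarrow> (real^'n) set" where
  "feasible G = {x. \<forall>i r. 0 \<le> slack G i (crows G i) (own G i x) (others G i x) $ r}"

definition GNE :: "('p, 'n::finite, 'm::finite) gnep \<Rightarrow> real^'n \<Rightarrow> bool" where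
  "GNE G u \<longleftrightarrow> (\<forall>i. is_arg_min (\<lambda>v. obj G i (v + others G i u))
                            (\<lambda>v. v \<in> feasible_i G i (others G i u)) (own G i u))"

definition grad_i :: "('p, 'n::finite, 'm::finite) gnep \<Rightarrow> 'p \<Rightarrow> real^'n \<Rightarrow> real^'n" where
  "grad_i G i x = restr (coords G i) (gradient (obj G i) x)"

definition KKT :: "('p, 'n::finite, 'm::finite) gnep \<Rightarrow> (real^'n) set" where
  "KKT G = {x \<in> feasible G. \<exists>l :: 'p \<Rightarrow> real^'m. \<forall>i.
      l i \<in> coord_space (crows G i) \<and>
      grad_i G i x - transpose (A_part G i (crows G i)) *v l i = 0 \<and>
      perp_nonneg (l i) (slack G i (crows G i) (own G i x) (others G i x))}"

definition P_i :: "('p, 'n::finite, 'm::finite) gnep \<Rightarrow> 'p \<Rightarrow> 'm set set" where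
  "P_i G i = {J. J \<subseteq> crows G i \<and> card J = rank (A_part G i (crows G i)) \<and>
                 rank (A_part G i J) = rank (A_part G i (crows G i))}"

definition P_all :: "('p, 'n::finite, 'm::finite) gnep \<Rightarrow> ('p \<Rightarrow> 'm set) set" where
  "P_all G = {J. \<forall>i. J i \<in> P_i G i}"

definition lam :: "('p, 'n::finite, 'm::finite) gnep \<Rightarrow> 'p \<Rightarrow> 'm set \<Rightarrow> real^'n \<Rightarrow> real^'m" where
  "lam G i J x = block_inv J (A_part G i J ** transpose (A_part G i J)) *v
                   (A_part G i J *v grad_i G i x)"

definition K_J :: "('p, 'n::finite, 'm::finite) gnep \<Rightarrow> ('p \<Rightarrow> 'm set) \<Rightarrow> (real^'n) set" where
  "K_J G J = {x \<in> feasible G. \<forall>i.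
      grad_i G i x - transpose (A_part G i (J i)) *v lam G i (J i) x = 0 \<and>
      perp_nonneg (lam G i (J i) x) (slack G i (J i) (own G i x) (others G i x))}"


section \<open>Generic symmetric matrices\<close>

text \<open>The matrices of size \<open>n + 1\<close> have index type \<open>'n option\<close>; \<open>None\<close> is the extra index.\<close>

definition hom1 :: "real^'n \<Rightarrow> real^'n option" where
  "hom1 x = (\<chi> j. case j of None \<Rightarrow> 1 | Some k \<Rightarrow> x $ k)"

definition theta :: "real^'n option^'n option \<Rightarrow> real^'n \<Rightarrow> real" where
  "theta T x = hom1 x \<bullet> (T *v hom1 x)"

definition sym_mats :: "(real^'a^'a) set" where
  "sym_mats = {T. transpose T = T}"

definition sym_pos_def :: "real^'a^'a \<Rightarrow> bool" where
  "sym_pos_def T \<longleftrightarrow> T \<in> sym_mats \<and> (\<forall>z. z \<noteq> 0 \<longrightarrow> 0 < z \<bullet> (T *v z))"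

text \<open>Zariski topology on \<open>V\<close>: the closed sets are the zero sets in \<open>V\<close> of sets of polynomials.\<close>

definition zariski_open :: "'v::real_normed_vector set \<Rightarrow> 'v set \<Rightarrow> bool" where
  "zariski_open V U \<longleftrightarrow> (\<exists>F. (\<forall>p\<in>F. real_polynomial_function p) \<and>
                            U = V - {x \<in> V. \<forall>p\<in>F. p x = 0})"

definition zariski :: "'v::real_normed_vector set \<Rightarrow> 'v topology" where
  "zariski V = topology (zariski_open V)"

lemma istopology_zariski_open: "istopology (zariski_open V)"
  unfolding istopology_def
proof (intro conjI allI impI)
  fix S T assume "zariski_open V S" "zariski_open V T"
  then obtain F H where F: "\<forall>p\<in>F. real_polynomial_function p" "S = V - {x \<in> V. \<forall>p\<in>F. p x = 0}"
    and H: "\<forall>p\<in>H. real_polynomial_function p" "T = V - {x \<in> V. \<forall>p\<in>H. p x = 0}"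
    unfolding zariski_open_def by blast
  let ?FH = "(\<lambda>(p, q) x. p x * q x) ` (F \<times> H)"
  have "\<forall>p\<in>?FH. real_polynomial_function p"
    using F(1) H(1) by (auto intro: real_polynomial_function.intros(4))
  moreover have "S \<inter> T = V - {x \<in> V. \<forall>p\<in>?FH. p x = 0}"
    unfolding F(2) H(2) by auto
  ultimately show "zariski_open V (S \<inter> T)"
    unfolding zariski_open_def by (intro exI[of _ ?FH] conjI)
next
  fix \<K> assume "\<forall>K\<in>\<K>. zariski_open V K"
  then have "\<forall>K\<in>\<K>. \<exists>F. (\<forall>p\<in>F. real_polynomial_function p) \<and>
      K = V - {x \<in> V. \<forall>p\<in>F. p x = 0}"
    unfolding zariski_open_def .
  then obtain F where F: "\<forall>K\<in>\<K>. (\<forall>p\<in>F K. real_polynomial_function p) \<and>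
      K = V - {x \<in> V. \<forall>p\<in>F K. p x = 0}"
    by (rule bchoice[THEN exE])
  let ?F = "\<Union>K\<in>\<K>. F K"
  have mem: "x \<in> K \<longleftrightarrow> x \<in> V \<and> (\<exists>p\<in>F K. p x \<noteq> 0)" if "K \<in> \<K>" for x K
  proof -
    have "K = V - {x \<in> V. \<forall>p\<in>F K. p x = 0}"
      using F that by (rule_tac conjunct2) (rule bspec)
    then have "x \<in> K \<longleftrightarrow> x \<in> V - {x \<in> V. \<forall>p\<in>F K. p x = 0}"
      by (rule arg_cong)
    then show ?thesis by blast
  qed
  have "\<Union>\<K> = V - {x \<in> V. \<forall>p\<in>?F. p x = 0}"
    using mem by (intro set_eqI) blast
  moreover have "\<forall>p\<in>?F. real_polynomial_function p"
    using F by simp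
  ultimately show "zariski_open V (\<Union>\<K>)"
    unfolding zariski_open_def by (intro exI[of _ ?F] conjI)
qed

lemma openin_zariski: "openin (zariski V) U \<longleftrightarrow> zariski_open V U"
  by (simp add: zariski_def topology_inverse' istopology_zariski_open)

definition holds_generically :: "(real^'a^'a \<Rightarrow> bool) \<Rightarrow> bool" where
  "holds_generically P \<longleftrightarrow> (\<exists>U. openin (zariski sym_mats) U \<and>
     zariski sym_mats closure_of U = sym_mats \<and> (\<forall>T\<in>U. P T))"


section \<open>The algorithms\<close>

text \<open>
  Optimal value of \<open>min {f\<^sub>i(v, u\<^sub>-\<^sub>i) - f\<^sub>i(u\<^sub>i, u\<^sub>-\<^sub>i) : v \<in> X\<^sub>i(u\<^sub>-\<^sub>i)}\<close>; it is \<open>-\<infinity>\<close> when the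
  problem is unbounded below.
\<close>

definition eps :: "('p, 'n::finite, 'm::finite) gnep \<Rightarrow> 'p \<Rightarrow> real^'n \<Rightarrow> ereal" where
  "eps G i u = (INF v \<in> feasible_i G i (others G i u).
                  ereal (obj G i (v + others G i u) - obj G i (own G i u + others G i u)))"

text \<open>
  Algorithm A as a transition system.  The states carry the values of the program variables needed
  from that step on: the current point \<open>u\<close> (which is \<open>u\<^sup>(\<^sup>j\<^sup>)\<close>), \<open>\<delta>\<close>, the value \<open>\<theta>\<^sub>m\<^sub>a\<^sub>x\<close>, and the
  set \<open>\<S>\<^sub>J\<close>.  Any choice among several minimizers is a possible transition; if an optimum
  that is asked for is not attained, the system is stuck in a non-final state.
\<close>

datatype 'n::finite state_A =
    Step1 real "(real^'n) set"
  | Step2 "real^'n" real "(real^'n) set"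
  | Step3 "real^'n" real "(real^'n) set"
  | Step4 "real^'n" real real "(real^'n) set"
  | Step5 "real^'n" real "(real^'n) set"
  | Stop_No_GNE "(real^'n) set"
  | Stop_All_GNEs "(real^'n) set"

inductive step_A ::
  "('p, 'n::finite, 'm::finite) gnep \<Rightarrow> real^'n option^'n option \<Rightarrow> ('p \<Rightarrow> 'm set) \<Rightarrow>
     'n state_A \<Rightarrow> 'n state_A \<Rightarrow> bool"
  for G T J where
  step1_infeasible:
    "K_J G J = {} \<Longrightarrow> step_A G T J (Step1 \<delta> S) (Stop_No_GNE S)"
| step1_min:
    "is_arg_min (theta T) (\<lambda>x. x \<in> K_J G J) u \<Longrightarrow>
     step_A G T J (Step1 \<delta> S) (Step2 u \<delta> S)"
| step2_accept:
    "\<forall>i. eps G i u \<ge> 0 \<Longrightarrow> step_A G T J (Step2 u \<delta> S) (Step3 u \<delta> (S \<union> {u}))"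
| step2_reject:
    "\<not> (\<forall>i. eps G i u \<ge> 0) \<Longrightarrow> step_A G T J (Step2 u \<delta> S) (Step3 u \<delta> S)"
| step3:
    "is_arg_max (theta T) (\<lambda>x. x \<in> K_J G J \<and> theta T x \<le> theta T u + \<delta>) y \<Longrightarrow>
     step_A G T J (Step3 u \<delta> S) (Step4 u \<delta> (theta T y) S)"
| step4_equal:
    "tmax = theta T u \<Longrightarrow> step_A G T J (Step4 u \<delta> tmax S) (Step5 u \<delta> S)"
| step4_halve:
    "tmax \<noteq> theta T u \<Longrightarrow> step_A G T J (Step4 u \<delta> tmax S) (Step3 u (\<delta> / 2) S)"
| step5_infeasible:
    "{x \<in> K_J G J. theta T x \<ge> theta T u + \<delta>} = {} \<Longrightarrow>
     step_A G T J (Step5 u \<delta> S) (Stop_All_GNEs S)"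
| step5_min:
    "is_arg_min (theta T) (\<lambda>x. x \<in> K_J G J \<and> theta T x \<ge> theta T u + \<delta>) u' \<Longrightarrow>
     step_A G T J (Step5 u \<delta> S) (Step2 u' \<delta> S)"

text \<open>
  Algorithm B.  \<open>Enum R S\<close>: the tuples in \<open>R\<close> are still to be enumerated and \<open>S\<close> is the current
  value of \<open>\<S>\<close>; \<open>Run_A R S J a\<close>: additionally Algorithm A is being executed for \<open>J\<close> and is in state
  \<open>a\<close>.  The order of enumeration and the initial \<open>\<delta> > 0\<close> of each call are arbitrary.
\<close>

datatype ('p, 'n::finite, 'm) state_B =
    Enum "('p \<Rightarrow> 'm set) set" "(real^'n) set"
  | Run_A "('p \<Rightarrow> 'm set) set" "(real^'n) set" "'p \<Rightarrow> 'm set" "'n state_A"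

inductive step_B ::
  "('p, 'n::finite, 'm::finite) gnep \<Rightarrow> real^'n option^'n option \<Rightarrow>
     ('p, 'n, 'm) state_B \<Rightarrow> ('p, 'n, 'm) state_B \<Rightarrow> bool"
  for G T where
  call_A:
    "J \<in> R \<Longrightarrow> \<delta> > 0 \<Longrightarrow> step_B G T (Enum R S) (Run_A (R - {J}) S J (Step1 \<delta> {}))"
| run_A:
    "step_A G T J a a' \<Longrightarrow> step_B G T (Run_A R S J a) (Run_A R S J a')"
| return_none:
    "step_B G T (Run_A R S J (Stop_No_GNE SJ)) (Enum R (S \<union> SJ))"
| return_all:
    "step_B G T (Run_A R S J (Stop_All_GNEs SJ)) (Enum R (S \<union> SJ))"

definition init_B :: "('p, 'n::finite, 'm::finite) gnep \<Rightarrow> ('p, 'n, 'm) state_B" where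
  "init_B G = Enum (P_all G) {}"

definition reachable_B ::
  "('p, 'n::finite, 'm::finite) gnep \<Rightarrow> real^'n option^'n option \<Rightarrow> ('p, 'n, 'm) state_B \<Rightarrow> bool" where
  "reachable_B G T s \<longleftrightarrow> (step_B G T)\<^sup>*\<^sup>* (init_B G) s"

definition outputs_B ::
  "('p, 'n::finite, 'm::finite) gnep \<Rightarrow> real^'n option^'n option \<Rightarrow> (real^'n) set \<Rightarrow> bool" where
  "outputs_B G T S \<longleftrightarrow> reachable_B G T (Enum {} S)"

text \<open>Every execution ends after finitely many steps, and only with all tuples enumerated.\<close>

definition terminates_B ::
  "('p, 'n::finite, 'm::finite) gnep \<Rightarrow> real^'n option^'n option \<Rightarrow> bool" where
  "terminates_B G T \<longleftrightarrow>
     \<not> (\<exists>\<sigma>. \<sigma> 0 = init_B G \<and> (\<forall>k::nat. step_B G T (\<sigma> k) (\<sigma> (Suc k)))) \<and>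
     (\<forall>s. reachable_B G T s \<and> (\<nexists>s'. step_B G T s s') \<longrightarrow> (\<exists>S. s = Enum {} S))"

end

theory Submission
  imports Defs
begin

text \<open>
  At an equilibrium the constraints are linear in the player's own variables, so by Farkas' lemma the
  gradient is a nonnegative combination of active rows; by Caratheodory's theorem for cones these
  rows can be taken linearly independent, and they extend to a basis of the row space, which is a
  tuple \<open>J \<in> \<P>\<close> with the equilibrium in \<open>K\<^sub>J\<close>.  Conversely every \<open>K\<^sub>J\<close> lies in the finite set of KKT
  points.  For \<open>\<Theta>\<close> outside the zero set of the product of all \<open>\<theta>(x) - \<theta>(y)\<close>, where \<open>x \<noteq> y\<close> are KKT
  points, \<open>\<theta>\<close> is injective on \<open>K\<^sub>J\<close>, and Algorithm A visits the points of \<open>K\<^sub>J\<close> one by one in increasing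
  order of \<open>\<theta>\<close>.
\<close>

section \<open>Finitely generated cones\<close>

lemma convex_cone_hull_finite_subset:
  fixes S :: "'a::euclidean_space set"
  assumes "finite S"
  shows "convex_cone hull S \<subseteq> {\<Sum>v\<in>S. c v *\<^sub>R v |c. \<forall>v\<in>S. 0 \<le> c v}" (is "_ \<subseteq> ?C")
proof (rule hull_minimal)
  show "S \<subseteq> ?C"
  proof
    fix a assume "a \<in> S"
    then have "a = (\<Sum>v\<in>S. (if v = a then 1 else 0) *\<^sub>R v)"
      using assms by (simp add: if_distrib [of "\<lambda>t. t *\<^sub>R _"] cong: if_cong)
    then show "a \<in> ?C" by (intro CollectI exI[of _ "\<lambda>v. if v = a then 1 else 0"]) auto
  qed
  show "convex_cone ?C"
    unfolding convex_cone_iff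
  proof (intro conjI ballI allI impI)
    show "0 \<in> ?C" by (auto intro!: exI[of _ "\<lambda>v. 0"])
  next
    fix x y assume "x \<in> ?C" "y \<in> ?C"
    then obtain c d where "x = (\<Sum>v\<in>S. c v *\<^sub>R v)" "\<forall>v\<in>S. 0 \<le> c v"
      "y = (\<Sum>v\<in>S. d v *\<^sub>R v)" "\<forall>v\<in>S. 0 \<le> d v" by blast
    then show "x + y \<in> ?C"
      by (intro CollectI exI[of _ "\<lambda>v. c v + d v"]) (auto simp: scaleR_add_left sum.distrib)
  next
    fix x and t :: real assume "x \<in> ?C" "0 \<le> t"
    then obtain c where "x = (\<Sum>v\<in>S. c v *\<^sub>R v)" "\<forall>v\<in>S. 0 \<le> c v" by blast
    then show "t *\<^sub>R x \<in> ?C" using \<open>0 \<le> t\<close>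
      by (intro CollectI exI[of _ "\<lambda>v. t * c v"]) (auto simp: scaleR_sum_right)
  qed
qed

lemma convex_cone_hull_caratheodory:
  fixes S :: "'a::euclidean_space set"
  assumes "finite S" "x \<in> convex_cone hull S"
  obtains V c where "V \<subseteq> S" "independent V" "\<forall>v\<in>V. 0 \<le> c v" "x = (\<Sum>v\<in>V. c v *\<^sub>R v)"
proof -
  \<comment> \<open>Subtracting a multiple of a linear relation from a representation of minimal support would
    shorten it.\<close>
  define P where "P V \<longleftrightarrow> V \<subseteq> S \<and> (\<exists>c. (\<forall>v\<in>V. 0 \<le> c v) \<and> x = (\<Sum>v\<in>V. c v *\<^sub>R v))" for V
  have "P S" using convex_cone_hull_finite_subset[OF assms(1)] assms(2) unfolding P_def by blast
  then obtain V where PV: "P V" and least: "\<And>W. P W \<Longrightarrow> card V \<le> card W"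
    using ex_has_least_nat[of P S card] by blast
  then obtain c where V: "V \<subseteq> S" "\<forall>v\<in>V. 0 \<le> c v" "x = (\<Sum>v\<in>V. c v *\<^sub>R v)"
    unfolding P_def by blast
  have fV: "finite V" using V(1) assms(1) finite_subset by blast
  have "independent V"
  proof
    assume "dependent V"
    then obtain u0 v0 where u0: "v0 \<in> V" "u0 v0 \<noteq> 0" "(\<Sum>v\<in>V. u0 v *\<^sub>R v) = 0"
      using dependent_finite[OF fV] by auto
    \<comment> \<open>The sign makes the coefficient at \<open>v0\<close> positive, so that
      \<open>W\<close> below is nonempty.\<close>
    define u where "u v = sgn (u0 v0) * u0 v" for v
    have u: "u v0 > 0" "(\<Sum>v\<in>V. u v *\<^sub>R v) = 0"
      using u0 by (auto simp: u_def sgn_if scaleR_sum_right[symmetric] sum_negf)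
    define W where "W = {v\<in>V. u v > 0}"
    have W: "finite W" "W \<noteq> {}" using fV u(1) u0(1) by (auto simp: W_def)
    obtain w where w: "w \<in> W" and wmin: "\<And>v. v \<in> W \<Longrightarrow> c w / u w \<le> c v / u v"
      using ex_min_if_finite[of "(\<lambda>v. c v / u v) ` W"] W by (auto simp: not_less)
    \<comment> \<open>The minimal ratio is the largest multiple of the relation that can be
      subtracted while all coefficients stay nonnegative; the one at \<open>w\<close> becomes
      zero.\<close>
    define t where "t = c w / u w"
    have t0: "0 \<le> t" using w V(2) by (auto simp: t_def W_def)
    have "\<forall>v\<in>V. 0 \<le> c v - t * u v"
    proof
      fix v assume v: "v \<in> V"
      show "0 \<le> c v - t * u v"
      proof (cases "u v > 0")
        case True
        then have "t \<le> c v / u v" using wmin v by (simp add: t_def W_def)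
        then show ?thesis using True by (simp add: field_simps)
      next
        case False
        then have "t * u v \<le> 0" using t0 by (simp add: mult_nonneg_nonpos)
        then show ?thesis using V(2) v by force
      qed
    qed
    moreover have "x = (\<Sum>v\<in>V - {w}. (c v - t * u v) *\<^sub>R v)"
    proof -
      have "x = (\<Sum>v\<in>V. (c v - t * u v) *\<^sub>R v)"
        using u(2) by (simp add: V(3) scaleR_diff_left sum_subtractf
            scaleR_scaleR[symmetric] scaleR_sum_right[symmetric] del: scaleR_scaleR)
      also have "\<dots> = (\<Sum>v\<in>V - {w}. (c v - t * u v) *\<^sub>R v)"
        using w fV by (intro sum.mono_neutral_right) (auto simp: W_def t_def)
      finally show ?thesis .
    qed
    ultimately have "P (V - {w})" using V(1) unfolding P_def
      by (intro conjI exI[of _ "\<lambda>v. c v - t * u v"]) auto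
    then have "card V \<le> card (V - {w})" by (rule least)
    moreover have "card (V - {w}) < card V"
      using w fV by (intro psubset_card_mono) (auto simp: W_def)
    ultimately show False by simp
  qed
  then show ?thesis using that V by blast
qed

text \<open>A finitely generated cone is closed, so a point outside it is strictly separated from it
  by a hyperplane, whose normal contradicts \<open>dual\<close>.\<close>

lemma farkas:
  fixes g :: "'a::euclidean_space"
  assumes "finite S" and dual: "\<And>d. (\<And>a. a \<in> S \<Longrightarrow> 0 \<le> a \<bullet> d) \<Longrightarrow> 0 \<le> g \<bullet> d"
  shows "g \<in> convex_cone hull S"
proof (rule ccontr)
  assume "g \<notin> convex_cone hull S"
  then obtain d b where d: "d \<bullet> g < b" "\<forall>x\<in>convex_cone hull S. d \<bullet> x > b"
    using separating_hyperplane_closed_point[of "convex_cone hull S" g]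
      convex_convex_cone_hull closed_convex_cone_hull[OF assms(1)] by blast
  have b: "b < 0" using d(2) convex_cone_hull_contains_0[of S] by force
  have "0 \<le> a \<bullet> d" if "a \<in> S" for a
  proof (rule ccontr)
    assume neg: "\<not> 0 \<le> a \<bullet> d"
    \<comment> \<open>Both \<open>b\<close> and \<open>a \<bullet> d\<close> are negative, so the
      factor is nonnegative; it is scaled to give inner product exactly \<open>b\<close> with
      \<open>d\<close>, where separation demands more than \<open>b\<close>.\<close>
    have "(b / (a \<bullet> d)) *\<^sub>R a \<in> convex_cone hull S"
      using neg b that by (intro convex_cone_hull_mul hull_inc) (auto simp: divide_nonpos_neg)
    then have "b < d \<bullet> ((b / (a \<bullet> d)) *\<^sub>R a)" using d(2) by blast
    then show False using neg by (simp add: inner_commute)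
  qed
  then have "0 \<le> g \<bullet> d" by (rule dual)
  then show False using d(1) b by (simp add: inner_commute)
qed

section \<open>Nonzero polynomials on a subspace and Zariski density\<close>

lemma real_polynomial_function_along_line:
  fixes p :: "'a::real_normed_vector \<Rightarrow> real"
  assumes "real_polynomial_function p"
  shows "real_polynomial_function (\<lambda>t. p (a + t *\<^sub>R b))"
  using assms
proof induction
  case (linear h)
  then interpret bounded_linear h .
  show ?case by (simp add: add scale)
      (intro real_polynomial_function.intros bounded_linear_mult_left)
next
  case (const c)
  then show ?case by (rule real_polynomial_function.intros(2))
next
  case (add f g)
  then show ?case by (intro real_polynomial_function.intros(3))
next
  case (mult f g)
  then show ?case by (intro real_polynomial_function.intros(4))
qed

lemma finite_roots_real_polynomial_function:
  fixes p :: "real \<Rightarrow> real"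
  assumes "real_polynomial_function p" "p a \<noteq> 0"
  shows "finite {t. p t = 0}"
proof -
  obtain c n where p: "p = (\<lambda>x. \<Sum>i\<le>n. c i * x ^ i)"
    using assms(1) real_polynomial_function_iff_sum by blast
  show ?thesis unfolding p polyfun_finite_roots
    using assms(2) by (auto simp: p intro!: sum.neutral dest: sum.not_neutral_contains_not_neutral)
qed

text \<open>On the line through \<open>a\<close> and \<open>b\<close>, which stays in
  \<open>V\<close>, both polynomials become univariate. Neither vanishes identically, as the
  parameters 0 and 1 show, so some parameter avoids their finitely many roots.\<close>

lemma real_polynomial_function_mult_nonzero_on_subspace:
  fixes p q :: "'a::real_normed_vector \<Rightarrow> real"
  assumes "real_polynomial_function p" "real_polynomial_function q" "subspace V"
    and a: "a \<in> V" "p a \<noteq> 0" and b: "b \<in> V" "q b \<noteq> 0"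
  shows "\<exists>x\<in>V. p x * q x \<noteq> 0"
proof -
  let ?l = "\<lambda>t. a + t *\<^sub>R (b - a)"
  have "finite {t. p (?l t) = 0}" "finite {t. q (?l t) = 0}"
    using finite_roots_real_polynomial_function[OF real_polynomial_function_along_line[OF assms(1)], where a = 0]
      finite_roots_real_polynomial_function[OF real_polynomial_function_along_line[OF assms(2)], where a = 1]
      a(2) b(2) by simp_all
  then have "finite ({t. p (?l t) = 0} \<union> {t. q (?l t) = 0})" by simp
  then obtain t where "t \<notin> {t. p (?l t) = 0} \<union> {t. q (?l t) = 0}"
    using ex_new_if_finite[OF infinite_UNIV_char_0] by blast
  moreover have "?l t \<in> V" using assms(3) a b by (simp add: subspace_add subspace_mul subspace_diff)
  ultimately show ?thesis by (intro bexI[of _ "?l t"]) auto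
qed

lemma real_polynomial_function_prod_nonzero_on_subspace:
  fixes p :: "'i \<Rightarrow> 'a::real_normed_vector \<Rightarrow> real"
  assumes "finite I" "subspace V" "\<And>i. i \<in> I \<Longrightarrow> real_polynomial_function (p i)"
    and "\<And>i. i \<in> I \<Longrightarrow> \<exists>x\<in>V. p i x \<noteq> 0"
  shows "\<exists>x\<in>V. (\<Prod>i\<in>I. p i x) \<noteq> 0"
  using assms
proof (induction I)
  case empty
  then show ?case using subspace_0 by auto
next
  case (insert i I)
  then obtain a b where "a \<in> V" "p i a \<noteq> 0" "b \<in> V" "(\<Prod>i\<in>I. p i b) \<noteq> 0" by blast
  moreover have "real_polynomial_function (\<lambda>x. \<Prod>i\<in>I. p i x)"
    using insert by (intro real_polynomial_function_prod) auto
  ultimately show ?case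
    using real_polynomial_function_mult_nonzero_on_subspace[of "p i" "\<lambda>x. \<Prod>i\<in>I. p i x" V a b] insert
    by auto
qed

section \<open>Density of nonvanishing sets in the Zariski topology\<close>

lemma topspace_zariski: "topspace (zariski V) = V"
proof -
  have "zariski_open V V" unfolding zariski_open_def
    by (intro exI[of _ "{\<lambda>x. 1}"]) (auto intro: real_polynomial_function.intros)
  then show ?thesis
    unfolding topspace_def openin_zariski by (auto simp: zariski_open_def)
qed

text \<open>A nonempty open set contains a point where one of its defining polynomials
  \<open>q\<close> is nonzero. Then \<open>p\<close> times \<open>q\<close> is nonzero somewhere on
  \<open>V\<close>, and that point lies in both sets.\<close>

lemma zariski_dense_nonzero_set:
  assumes "subspace V" "real_polynomial_function p" "a \<in> V" "p a \<noteq> 0"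
  shows "zariski V closure_of {x \<in> V. p x \<noteq> 0} = V"
proof -
  have "\<exists>y. y \<in> {x \<in> V. p x \<noteq> 0} \<and> y \<in> T" if T: "x \<in> T" "zariski_open V T" for x T
  proof -
    obtain F where F: "\<forall>q\<in>F. real_polynomial_function q" "T = V - {x \<in> V. \<forall>q\<in>F. q x = 0}"
      using T(2) unfolding zariski_open_def by blast
    then obtain q where q: "q \<in> F" "q x \<noteq> 0" "x \<in> V" using T(1) by blast
    then obtain y where "y \<in> V" "p y * q y \<noteq> 0"
      using real_polynomial_function_mult_nonzero_on_subspace[OF assms(2) _ assms(1,3,4), of q x] F
      by blast
    then show ?thesis using F(2) q(1) by auto
  qed
  then show ?thesis unfolding closure_of_def topspace_zariski openin_zariski by blast
qed

section \<open>The value of theta as a function of the matrix\<close>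

lemma subspace_sym_mats: "subspace sym_mats"
  by (auto simp: subspace_def sym_mats_def transpose_def vec_eq_iff)

text \<open>For a fixed point the quadratic form is linear in the matrix.\<close>

lemma real_polynomial_function_theta: "real_polynomial_function (\<lambda>T. theta T x)"
proof (rule real_polynomial_function.intros(1))
  show "bounded_linear (\<lambda>T. theta T x)"
    unfolding linear_conv_bounded_linear[symmetric]
    by (simp add: linear_iff theta_def matrix_vector_mult_add_rdistrib
        inner_add_right scaleR_matrix_vector_assoc[symmetric])
qed

text \<open>The symmetric matrix pairing the extra index with a coordinate \<open>k\<close> where
  the points differ has the form \<open>2 * z $ k\<close>.\<close>

lemma theta_separates:
  fixes x y :: "real^'n::finite"
  assumes "x \<noteq> y"
  shows "\<exists>T\<in>sym_mats. theta T x \<noteq> theta T y"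
proof -
  obtain k where k: "x $ k \<noteq> y $ k" using assms by (auto simp: vec_eq_iff)
  let ?T = "(\<chi> i j. if {i, j} = {None, Some k} then 1 else 0) :: real^'n option^'n option"
  \<comment> \<open>The unordered pair makes symmetry evident; the sum of two indicators makes the
    matrix-vector product computable.\<close>
  have T: "?T = (\<chi> i j. (if i = None \<and> j = Some k then 1 else 0) + (if i = Some k \<and> j = None then 1 else 0))"
    by (auto simp: vec_eq_iff doubleton_eq_iff)
  have "?T \<in> sym_mats" by (simp add: sym_mats_def transpose_def vec_eq_iff insert_commute)
  moreover have "theta ?T z = 2 * z $ k" for z
  proof -
    have "(?T *v hom1 z) $ i = (if i = None then z $ k else if i = Some k then 1 else 0)" for i
      unfolding T matrix_vector_mult_def
      by (cases i) (auto simp: hom1_def if_distrib [of "\<lambda>t. t * _"] sum.distrib distrib_right cong: if_cong)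
    then show ?thesis
      by (simp add: theta_def inner_vec_def UNIV_option_conv hom1_def sum.reindex
          if_distrib [of "\<lambda>t. _ * t"] cong: if_cong)
  qed
  ultimately show ?thesis using k by (intro bexI[of _ ?T]) auto
qed

lemma holds_generically_mono:
  assumes "holds_generically P" "\<And>T. P T \<Longrightarrow> Q T"
  shows "holds_generically Q"
  using assms unfolding holds_generically_def by meson

lemma generically_inj_on_theta:
  fixes K :: "(real^'n::finite) set"
  assumes "finite K"
  shows "holds_generically (\<lambda>T :: real^'n option^'n option. inj_on (theta T) K)"
proof -
  define I where "I = {(x, y). x \<in> K \<and> y \<in> K \<and> x \<noteq> y}"
  define p where "p T = (\<Prod>(x, y)\<in>I. theta T x - theta T y)" for T :: "real^'n option^'n option"
  have "I \<subseteq> K \<times> K" by (auto simp: I_def)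
  then have fin: "finite I" using assms finite_subset by blast
  have poly: "real_polynomial_function (case z of (x, y) \<Rightarrow> \<lambda>T. theta T x - theta T y)" for z :: "(real^'n) \<times> (real^'n)"
    by (cases z) (auto intro: real_polynomial_function_theta)
  \<comment> \<open>The case distinction is moved outside the application, so that each factor is a
    function of the matrix, as the product lemmas expect.\<close>
  have p: "p = (\<lambda>T. \<Prod>z\<in>I. (case z of (x, y) \<Rightarrow> \<lambda>T. theta T x - theta T y) T)"
    by (auto simp: p_def fun_eq_iff intro!: prod.cong)
  have "real_polynomial_function p"
    unfolding p using fin poly by (rule real_polynomial_function_prod)
  moreover obtain T0 :: "real^'n option^'n option" where "T0 \<in> sym_mats" "p T0 \<noteq> 0"
  proof -
    have "\<exists>T\<in>sym_mats. p T \<noteq> 0"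
      unfolding p using fin subspace_sym_mats poly
    proof (rule real_polynomial_function_prod_nonzero_on_subspace)
      fix z assume "z \<in> I"
      then show "\<exists>T\<in>sym_mats. (case z of (x, y) \<Rightarrow> \<lambda>T. theta T x - theta T y) T \<noteq> 0"
        using theta_separates by (auto simp: I_def)
    qed
    then show ?thesis using that by blast
  qed
  moreover have "inj_on (theta T) K" if "p T \<noteq> 0" for T
  proof (rule inj_onI, rule ccontr)
    fix x y assume "x \<in> K" "y \<in> K" "theta T x = theta T y" "x \<noteq> y"
    then have "p T = 0" unfolding p_def
      by (intro prod_zero[OF fin] bexI[of _ "(x, y)"]) (auto simp: I_def)
    then show False using that by simp
  qed
  moreover have "zariski_open sym_mats {T \<in> sym_mats. p T \<noteq> 0}"
    unfolding zariski_open_def using \<open>real_polynomial_function p\<close> by (intro exI[of _ "{p}"]) auto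
  ultimately show ?thesis
    unfolding holds_generically_def openin_zariski
    by (intro exI[of _ "{T \<in> sym_mats. p T \<noteq> 0}"] conjI
        zariski_dense_nonzero_set[OF subspace_sym_mats, of p T0]) simp_all
qed

section \<open>Multipliers and the sets \<open>K\<^sub>J\<close>\<close>

lemma restr_nth [simp]: "restr I v $ k = (if k \<in> I then v $ k else 0)"
  by (simp add: restr_def)

lemma restr_in_coord_space: "restr I v \<in> coord_space I"
  by (simp add: coord_space_def)

lemma restr_coord_space: "v \<in> coord_space I \<Longrightarrow> restr I v = v"
  by (auto simp: coord_space_def vec_eq_iff)

lemma inner_restr_left: "restr I v \<bullet> w = restr I v \<bullet> restr I w"
  by (auto simp: inner_vec_def intro: sum.cong)

lemma own_plus_others: "own G i x + others G i x = x"
  by (auto simp: own_def others_def vec_eq_iff)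

lemma submat_mat_1_nth: "submat I I (mat 1) $ r $ k = (if r = k then if r \<in> I then 1 else 0 else 0)"
  by (auto simp: submat_def mat_def)

lemma submat_mat_1_mult_vec: "submat I I (mat 1) *v x = restr I x" for x :: "real^'n::finite"
proof -
  have "(\<Sum>k\<in>UNIV. submat I I (mat 1) $ r $ k * x $ k) = (\<Sum>k\<in>UNIV. if r = k then restr I x $ r else 0)" for r
    by (intro sum.cong) (auto simp: submat_mat_1_nth)
  then show ?thesis by (simp add: vec_eq_iff matrix_vector_mult_def)
qed

lemma submat_mat_1_mult: "submat I I (mat 1) ** B = submat I UNIV B" for B :: "real^'n::finite^'m::finite"
proof -
  have "(\<Sum>j\<in>UNIV. submat I I (mat 1) $ r $ j * B $ j $ k) =
      (\<Sum>j\<in>UNIV. if r = j then if r \<in> I then B $ r $ k else 0 else 0)" for r k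
    by (intro sum.cong) (auto simp: submat_mat_1_nth)
  then show ?thesis by (simp add: vec_eq_iff matrix_matrix_mult_def submat_def)
qed

lemma mult_submat_mat_1: "B ** submat K K (mat 1) = submat UNIV K B" for B :: "real^'n::finite^'m::finite"
proof -
  have "(\<Sum>j\<in>UNIV. B $ r $ j * submat K K (mat 1) $ j $ k) =
      (\<Sum>j\<in>UNIV. if j = k then if k \<in> K then B $ r $ k else 0 else 0)" for r k
    by (intro sum.cong) (auto simp: submat_mat_1_nth)
  then show ?thesis by (simp add: vec_eq_iff matrix_matrix_mult_def submat_def)
qed

text \<open>\<open>submat I I (mat 1)\<close> is the coordinate projection onto
  \<open>coord_space I\<close>. Expressing blocks by such projections turns support conditions into
  equations between matrix products.\<close>

lemma submat_conv_mult: "submat I K B = submat I I (mat 1) ** B ** submat K K (mat 1)"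
  for B :: "real^'n::finite^'m::finite"
  by (simp add: submat_mat_1_mult mult_submat_mat_1) (simp add: submat_def vec_eq_iff)

text \<open>The definite description in \<open>block_inv\<close> can be used only after existence
  and uniqueness are shown; injectivity on \<open>coord_space J\<close> yields both.\<close>

lemma block_inv_mult:
  fixes B :: "real^'m^'m"
  assumes B: "submat J J B = B"
    and inj: "\<And>c. c \<in> coord_space J \<Longrightarrow> B *v c = 0 \<Longrightarrow> c = 0"
  shows "submat J J (block_inv J B) = block_inv J B" "block_inv J B ** B = submat J J (mat 1)"
proof -
  define P :: "real^'m^'m" where "P = submat J J (mat 1)"
  have Pv: "P *v x = restr J x" for x
    unfolding P_def by (rule submat_mat_1_mult_vec)
  have sub: "submat J J C = P ** C ** P" for C unfolding P_def by (rule submat_conv_mult)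
  have PP: "P ** P = P" by (simp add: matrix_eq matrix_vector_mul_assoc[symmetric] Pv vec_eq_iff)
  have PB: "P ** B = B" "B ** P = B" using B unfolding sub
    by (metis PP matrix_mul_assoc)+
  \<comment> \<open>Completing the block by the identity on the complement of \<open>J\<close> gives an invertible matrix.\<close>
  define M where "M = B + (mat 1 - P)"
  have "x = 0" if "M *v x = 0" for x
  proof -
    have 0: "B *v x + (x - P *v x) = 0"
      using that by (simp add: M_def matrix_vector_mult_add_rdistrib matrix_vector_mult_diff_rdistrib)
    then have "P *v (B *v x + (x - P *v x)) = 0" by simp
    then have B0: "B *v x = 0"
      by (simp add: matrix_vector_right_distrib matrix_vector_mult_diff_distrib matrix_vector_mul_assoc PP PB)
    then have "x = P *v x" using 0 by simp
    moreover have "B *v (P *v x) = 0" using B0 by (simp add: matrix_vector_mul_assoc PB)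
    ultimately show "x = 0" using inj[OF restr_in_coord_space, of x] by (simp add: Pv)
  qed
  then obtain M' where M': "M' ** M = mat 1" using matrix_left_invertible_ker by blast
  then have MM': "M ** M' = mat 1" using matrix_left_right_inverse by blast
  have MP: "M ** P = B" "P ** M = B"
    by (simp_all add: M_def matrix_eq matrix_vector_mul_assoc[symmetric] matrix_vector_mult_add_rdistrib
        matrix_vector_mult_diff_rdistrib matrix_vector_right_distrib matrix_vector_mult_diff_distrib)
      (simp_all add: matrix_vector_mul_assoc PP PB)
  \<comment> \<open>\<open>M\<close> commutes with \<open>P\<close>, hence so does its inverse;
    therefore \<open>M' ** P\<close> is supported on the block and inverts \<open>B\<close>
    there.\<close>
  have M'P: "M' ** P = P ** M'"
    by (metis M' MM' MP matrix_mul_assoc matrix_mul_lid matrix_mul_rid)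
  let ?Q = "\<lambda>C. submat J J C = C \<and> B ** C = submat J J (mat 1) \<and> C ** B = submat J J (mat 1)"
  have ex: "?Q (M' ** P)"
    unfolding sub P_def[symmetric]
    by (metis M' MM' MP M'P PP PB matrix_mul_assoc matrix_mul_lid matrix_mul_rid)
  \<comment> \<open>The usual comparison of a left and a right inverse, with \<open>P\<close> as the
    identity.\<close>
  have "C = M' ** P" if "?Q C" for C
  proof -
    have "C = C ** P" using that unfolding sub P_def[symmetric] by (metis PP matrix_mul_assoc)
    also have "\<dots> = C ** B ** (M' ** P)" using ex by (simp add: P_def matrix_mul_assoc[symmetric])
    also have "\<dots> = P ** (M' ** P)" using that by (simp add: P_def)
    also have "\<dots> = M' ** P" by (simp add: matrix_mul_assoc M'P[symmetric])
      (simp add: matrix_mul_assoc[symmetric] PP)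
    finally show ?thesis .
  qed
  from theI[of ?Q, OF ex this] have "?Q (block_inv J B)" unfolding block_inv_def .
  then show "submat J J (block_inv J B) = block_inv J B" "block_inv J B ** B = submat J J (mat 1)"
    by auto
qed

section \<open>Rows of the constraint matrices: rank, bases and the multiplier formula\<close>

definition crow :: "('p, 'n::finite, 'm::finite) gnep \<Rightarrow> 'p \<Rightarrow> 'm \<Rightarrow> real^'n" where
  "crow G i r = restr (coords G i) (row r (Amat G i))"

lemma crow_in_coord_space: "crow G i r \<in> coord_space (coords G i)"
  by (simp add: crow_def restr_in_coord_space)

lemma A_part_nth: "A_part G i J $ r = (if r \<in> J then crow G i r else 0)"
  by (auto simp: A_part_def submat_def crow_def vec_eq_iff row_def)

lemma A_part_mult_nth: "(A_part G i J *v v) $ r = (if r \<in> J then crow G i r \<bullet> v else 0)"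
  by (simp add: matrix_vector_mul_component A_part_nth)

lemma transpose_A_part_mult: "transpose (A_part G i J) *v c = (\<Sum>r\<in>J. c $ r *\<^sub>R crow G i r)"
proof -
  have "(transpose (A_part G i J) *v c) $ k = (\<Sum>r\<in>UNIV. if r \<in> J then c $ r * crow G i r $ k else 0)" for k
    by (auto simp: matrix_vector_mult_def transpose_def A_part_nth intro!: sum.cong)
  then show ?thesis by (simp add: vec_eq_iff sum.If_cases)
qed

text \<open>Zero padding adds at most the zero vector to the rows, which leaves the dimension
  unchanged.\<close>

lemma rank_A_part: "rank (A_part G i J) = dim (crow G i ` J)"
proof -
  have "rows (A_part G i J) \<subseteq> insert 0 (crow G i ` J)" "crow G i ` J \<subseteq> rows (A_part G i J)"
    by (auto simp: rows_def row_def A_part_nth)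
  then have "dim (rows (A_part G i J)) \<le> dim (insert 0 (crow G i ` J))"
    "dim (crow G i ` J) \<le> dim (rows (A_part G i J))"
    using dim_subset by blast+
  then show ?thesis by (simp add: row_rank_def dim_insert span_0)
qed

text \<open>The dimension is at most the number of distinct rows, which is at most the number of
  labels. Membership in \<open>P_i\<close> makes the two ends equal, which excludes repeated rows
  and linear relations.\<close>

lemma P_i_independent:
  assumes "J \<in> P_i G i"
  shows "J \<subseteq> crows G i" "inj_on (crow G i) J" "independent (crow G i ` J)"
proof -
  have J: "J \<subseteq> crows G i" "dim (crow G i ` J) = card J"
    using assms by (auto simp: P_i_def rank_A_part)
  then show "J \<subseteq> crows G i" by simp
  have "dim (crow G i ` J) \<le> card (crow G i ` J)"
    by (simp add: dim_le_card')
  moreover have "card (crow G i ` J) \<le> card J" by (simp add: card_image_le)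
  ultimately have "card (crow G i ` J) = card J" using J by simp
  then show "inj_on (crow G i) J" by (simp add: eq_card_imp_inj_on)
  show "independent (crow G i ` J)"
    by (rule card_le_dim_spanning[OF subset_refl span_superset])
      (simp_all add: J \<open>card (crow G i ` J) = card J\<close>)
qed

lemma P_iI:
  assumes "J \<subseteq> crows G i" "inj_on (crow G i) J" "independent (crow G i ` J)"
    "crow G i ` crows G i \<subseteq> span (crow G i ` J)"
  shows "J \<in> P_i G i"
proof -
  have "dim (crow G i ` crows G i) = card (crow G i ` J)"
    by (rule dim_unique) (use assms in auto)
  moreover have "dim (crow G i ` J) = card (crow G i ` J)"
    by (rule dim_eq_card_independent) (use assms in auto)
  ultimately show ?thesis using assms by (simp add: P_i_def rank_A_part card_image)
qed

lemma P_i_transpose_injective: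
  assumes "J \<in> P_i G i" "c \<in> coord_space J" "transpose (A_part G i J) *v c = 0"
  shows "c = 0"
proof -
  note J = P_i_independent[OF assms(1)]
  \<comment> \<open>Since \<open>crow G i\<close> is injective on \<open>J\<close>, the sum over
    labels can be read as a sum over vectors, the form in which independence applies.\<close>
  have "(\<Sum>v\<in>crow G i ` J. c $ (inv_into J (crow G i) v) *\<^sub>R v) = 0"
    using assms(3) J(2) unfolding transpose_A_part_mult by (simp add: sum.reindex)
  then have "c $ inv_into J (crow G i) v = 0" if "v \<in> crow G i ` J" for v
    using independentD[OF J(3), of "crow G i ` J" "\<lambda>v. c $ inv_into J (crow G i) v" v] that by simp
  then have "c $ r = 0" if "r \<in> J" for r using that J(2) by fastforce
  then show ?thesis using assms(2) by (auto simp: vec_eq_iff coord_space_def)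
qed

text \<open>With \<open>A\<close> the block, \<open>c \<bullet> (A A^T c)\<close> is the squared
  norm of \<open>A^T c\<close>, so independence of the rows makes \<open>A A^T\<close> injective on
  \<open>coord_space J\<close>. The formula for \<open>lam\<close> then applies a left inverse of
  \<open>A^T\<close> to the gradient.\<close>

lemma
  assumes "J \<in> P_i G i"
  shows lam_in_coord_space: "lam G i J x \<in> coord_space J"
    and lam_unique: "\<And>c. c \<in> coord_space J \<Longrightarrow> grad_i G i x = transpose (A_part G i J) *v c \<Longrightarrow>
           lam G i J x = c"
proof -
  let ?A = "A_part G i J"
  let ?B = "?A ** transpose ?A"
  have B: "submat J J ?B = ?B"
    by (simp add: vec_eq_iff submat_def matrix_matrix_mult_def transpose_def A_part_nth)
  have inj: "c = 0" if "c \<in> coord_space J" "?B *v c = 0" for c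
  proof -
    have "(transpose ?A *v c) \<bullet> (transpose ?A *v c) = c \<bullet> (?A *v (transpose ?A *v c))"
      by (simp add: dot_lmul_matrix)
    also have "\<dots> = 0" unfolding matrix_vector_mul_assoc that(2) by simp
    finally show ?thesis using P_i_transpose_injective[OF assms that(1)] by simp
  qed
  note inv = block_inv_mult[OF B inj]
  have "(submat J J C *v v) $ r = 0" if "r \<notin> J" for r C v
    using that by (simp add: matrix_vector_mult_def submat_def)
  moreover have "lam G i J x = submat J J (block_inv J ?B) *v (?A *v grad_i G i x)"
    using inv(1) by (simp add: lam_def)
  ultimately show "lam G i J x \<in> coord_space J" by (simp add: coord_space_def)
  show "lam G i J x = c" if "c \<in> coord_space J" "grad_i G i x = transpose ?A *v c" for c
  proof -
    have "lam G i J x = (block_inv J ?B ** ?B) *v c"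
      by (simp only: lam_def that(2) matrix_vector_mul_assoc matrix_mul_assoc)
    also have "\<dots> = submat J J (mat 1) *v c" using inv(2) by simp
    also have "\<dots> = restr J c" by (rule submat_mat_1_mult_vec)
    also have "\<dots> = c" using that(1) by (rule restr_coord_space)
    finally show ?thesis .
  qed
qed

lemma slack_nth: "slack G i J v w $ r = (if r \<in> J then crow G i r \<bullet> v - bvec G i w $ r else 0)"
  by (simp add: slack_def b_part_def A_part_mult_nth)

text \<open>The multiplier of the block vanishes outside \<open>J i\<close>, so the same padded
  vector serves for all constraints of the player; the remaining slacks are nonnegative by
  feasibility.\<close>

lemma K_J_subset_KKT:
  assumes "J \<in> P_all G"
  shows "K_J G J \<subseteq> KKT G"
proof
  fix x assume x: "x \<in> K_J G J"
  have "lam G i (J i) x \<in> coord_space (crows G i) \<and>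
      grad_i G i x - transpose (A_part G i (crows G i)) *v lam G i (J i) x = 0 \<and>
      perp_nonneg (lam G i (J i) x) (slack G i (crows G i) (own G i x) (others G i x))" for i
  proof -
    have Ji: "J i \<in> P_i G i" using assms by (simp add: P_all_def)
    note sub = P_i_independent(1)[OF Ji]
    note supp = lam_in_coord_space[OF Ji, of x]
    have "transpose (A_part G i (crows G i)) *v lam G i (J i) x = transpose (A_part G i (J i)) *v lam G i (J i) x"
      unfolding transpose_A_part_mult using supp sub
      by (intro sum.mono_neutral_right) (auto simp: coord_space_def)
    moreover have "lam G i (J i) x \<bullet> slack G i (crows G i) (own G i x) (others G i x) =
        lam G i (J i) x \<bullet> slack G i (J i) (own G i x) (others G i x)"
      unfolding inner_vec_def using supp sub
      by (intro sum.cong) (auto simp: coord_space_def slack_nth)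
    ultimately show ?thesis
      using x supp sub by (auto simp: K_J_def perp_nonneg_def feasible_def coord_space_def)
  qed
  moreover have "x \<in> feasible G" using x by (simp add: K_J_def)
  ultimately show "x \<in> KKT G"
    unfolding KKT_def by (intro CollectI conjI exI[of _ "\<lambda>i. lam G i (J i) x"]) auto
qed

section \<open>First-order conditions at an equilibrium\<close>

lemma own_feasible: "x \<in> feasible G \<Longrightarrow> own G i x \<in> feasible_i G i (others G i x)"
  by (simp add: feasible_def feasible_i_def own_def restr_in_coord_space)

lemma GNE_feasible: "GNE G u \<Longrightarrow> u \<in> feasible G"
  by (auto simp: GNE_def is_arg_min_def feasible_i_def feasible_def)

text \<open>The infimum is nonnegative exactly when no admissible deviation improves the objective,
  whether or not it is attained; feasibility of \<open>u\<close> makes the player's own strategy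
  admissible.\<close>

lemma eps_nonneg_iff_GNE:
  assumes "u \<in> feasible G"
  shows "(\<forall>i. 0 \<le> eps G i u) \<longleftrightarrow> GNE G u"
  using own_feasible[OF assms]
  by (auto simp: eps_def GNE_def is_arg_min_def le_INF_iff not_less)

lemma inner_grad_i:
  assumes "obj G i differentiable (at u)" "d \<in> coord_space (coords G i)"
  shows "grad_i G i u \<bullet> d = frechet_derivative (obj G i) (at u) d"
proof -
  let ?f' = "frechet_derivative (obj G i) (at u)"
  have lin: "linear ?f'" using assms(1) by (rule linear_frechet_derivative)
  have "?f' d = ?f' (\<Sum>k\<in>UNIV. d $ k *\<^sub>R axis k 1)"
    using basis_expansion[of d] by (simp add: scalar_mult_eq_scaleR)
  also have "\<dots> = (\<Sum>k\<in>UNIV. d $ k * ?f' (axis k 1))"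
    by (simp add: linear_sum[OF lin] linear_cmul[OF lin])
  also have "\<dots> = grad_i G i u \<bullet> d"
    using assms(2) by (auto simp: inner_vec_def grad_i_def gradient_def coord_space_def intro!: sum.cong)
  finally show ?thesis ..
qed

text \<open>If the gradient were negative along \<open>d\<close>, a short move along
  \<open>d\<close> in the player's own coordinates would lower the objective. It stays feasible
  because the constraints are affine in these coordinates and inactive ones have room.\<close>

lemma GNE_first_order:
  assumes "GNE G u" "obj G i differentiable (at u)"
    and act: "\<And>r. r \<in> crows G i \<Longrightarrow> slack G i (crows G i) (own G i u) (others G i u) $ r = 0 \<Longrightarrow>
           0 \<le> crow G i r \<bullet> d"
  shows "0 \<le> grad_i G i u \<bullet> d"
proof (rule ccontr)
  \<comment> \<open>Farkas' lemma ranges over all directions; projecting to the player's coordinates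
    preserves the inner products with the gradient and the rows.\<close>
  define e where "e = restr (coords G i) d"
  define s where "s = slack G i (crows G i) (own G i u) (others G i u)"
  have e: "e \<in> coord_space (coords G i)" by (simp add: e_def restr_in_coord_space)
  have inner_e: "v \<bullet> e = v \<bullet> d" if "v \<in> coord_space (coords G i)" for v
    using inner_restr_left[of "coords G i" v d] that by (simp add: e_def restr_coord_space)
  assume "\<not> 0 \<le> grad_i G i u \<bullet> d"
  then have neg: "frechet_derivative (obj G i) (at u) e < 0"
    using inner_grad_i[OF assms(2) e] inner_e[of "grad_i G i u"]
    by (simp add: grad_i_def restr_in_coord_space)
  \<comment> \<open>The base point is written with \<open>0 *\<^sub>R e\<close> to match the inner
    function of the chain rule at parameter 0.\<close>
  have "(obj G i has_derivative frechet_derivative (obj G i) (at u)) (at (u + 0 *\<^sub>R e))"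
    using assms(2) by (simp add: frechet_derivative_works)
  then have "((\<lambda>t. obj G i (u + t *\<^sub>R e)) has_derivative
      (\<lambda>t. frechet_derivative (obj G i) (at u) (t *\<^sub>R e))) (at 0)"
    by (rule has_derivative_compose[rotated]) (auto intro!: derivative_eq_intros)
  then have "DERIV (\<lambda>t. obj G i (u + t *\<^sub>R e)) 0 :> frechet_derivative (obj G i) (at u) e"
    using linear_frechet_derivative[OF assms(2)]
    by (simp add: has_field_derivative_def linear_cmul mult.commute[of _ "frechet_derivative (obj G i) (at u) e"])
  from DERIV_neg_dec_right[OF this neg]
  have dec: "\<forall>\<^sub>F t in at_right 0. obj G i (u + t *\<^sub>R e) < obj G i u"
    by (auto simp: eventually_at_right_field)
  have "\<forall>\<^sub>F t in at_right 0. 0 \<le> slack G i (crows G i) (own G i u + t *\<^sub>R e) (others G i u) $ r" for r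
  proof -
    have s0: "0 \<le> s $ r" using GNE_feasible[OF assms(1)] by (simp add: feasible_def s_def)
    have eq: "slack G i (crows G i) (own G i u + t *\<^sub>R e) (others G i u) $ r
        = s $ r + t * (if r \<in> crows G i then crow G i r \<bullet> d else 0)" for t
      by (simp add: slack_nth s_def inner_add_right inner_e crow_in_coord_space)
    show ?thesis
    proof (cases "r \<in> crows G i \<longrightarrow> 0 \<le> crow G i r \<bullet> d")
      case True
      then show ?thesis using s0 unfolding eq
        by (intro eventually_at_rightI[of 0 1]) auto
    next
      case False
      \<comment> \<open>By \<open>act\<close>, a constraint with negative slope cannot be active,
        and a positive slack persists for small \<open>t\<close>.\<close>
      then have "0 < s $ r" using act s0 by (force simp: s_def)
      moreover have "((\<lambda>t. s $ r + t * (if r \<in> crows G i then crow G i r \<bullet> d else 0))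
          \<longlongrightarrow> s $ r + 0 * (if r \<in> crows G i then crow G i r \<bullet> d else 0)) (at_right 0)"
        by (intro tendsto_intros)
      ultimately show ?thesis unfolding eq
        by (auto dest!: order_tendstoD(1)[where a = 0] elim: eventually_mono)
    qed
  qed
  then have "\<forall>\<^sub>F t in at_right 0. \<forall>r. 0 \<le> slack G i (crows G i) (own G i u + t *\<^sub>R e) (others G i u) $ r"
    by (rule eventually_all_finite)
  with dec have "\<forall>\<^sub>F t in at_right (0::real). obj G i (u + t *\<^sub>R e) < obj G i u \<and>
      (\<forall>r. 0 \<le> slack G i (crows G i) (own G i u + t *\<^sub>R e) (others G i u) $ r)"
    by (rule eventually_conj)
  then obtain t where t: "obj G i (u + t *\<^sub>R e) < obj G i u"
    "\<forall>r. 0 \<le> slack G i (crows G i) (own G i u + t *\<^sub>R e) (others G i u) $ r"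
    using eventually_happens[of _ "at_right (0::real)"] by auto
  have "own G i u + t *\<^sub>R e \<in> feasible_i G i (others G i u)"
    using t(2) e by (simp add: feasible_i_def own_def coord_space_def)
  moreover have "own G i u + t *\<^sub>R e + others G i u = u + t *\<^sub>R e"
    using own_plus_others[of G i u] by (simp add: algebra_simps)
  ultimately show False using assms(1) t(1) own_plus_others[of G i u]
    unfolding GNE_def is_arg_min_def by metis
qed

lemma GNE_in_K_J:
  assumes "GNE G u" and diff: "\<And>i. obj G i differentiable (at u)"
  shows "\<exists>J\<in>P_all G. u \<in> K_J G J"
proof -
  let ?s = "\<lambda>i. slack G i (crows G i) (own G i u) (others G i u)"
  have "\<exists>J. J \<in> P_i G i \<and> grad_i G i u - transpose (A_part G i J) *v lam G i J u = 0 \<and>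
      perp_nonneg (lam G i J u) (slack G i J (own G i u) (others G i u))" for i
  proof -
    define a where "a = crow G i"
    define Act where "Act = {r \<in> crows G i. ?s i $ r = 0}"
    have "grad_i G i u \<in> convex_cone hull (a ` Act)"
      by (rule farkas) (auto simp: a_def Act_def intro!: GNE_first_order[OF assms(1) diff])
    then obtain V c where V: "V \<subseteq> a ` Act" "independent V" "\<forall>v\<in>V. 0 \<le> c v"
      "grad_i G i u = (\<Sum>v\<in>V. c v *\<^sub>R v)"
      by (rule convex_cone_hull_caratheodory[rotated]) auto
    \<comment> \<open>Equal rows may have different slacks, so the rows representing \<open>V\<close> are chosen among the
      active ones before they are extended to \<open>J\<close>.\<close>
    obtain I where I: "I \<subseteq> Act" "inj_on a I" "V = a ` I"
      using V(1) by (auto simp: subset_image_inj)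
    have "V \<subseteq> a ` crows G i" using V(1) by (auto simp: Act_def)
    then obtain W where W: "V \<subseteq> W" "W \<subseteq> a ` crows G i" "independent W" "a ` crows G i \<subseteq> span W"
      using maximal_independent_subset_extend[OF _ V(2)] by blast
    \<comment> \<open>The added labels represent only \<open>W - V\<close>, so their rows differ
      from those of \<open>I\<close> and \<open>a\<close> stays injective on the union.\<close>
    obtain I' where I': "I' \<subseteq> crows G i" "inj_on a I'" "W - V = a ` I'"
      using W(2) subset_image_inj[of "W - V" a "crows G i"] by blast
    define J where "J = I \<union> I'"
    have aJ: "a ` J = W" using I(3) I'(3) W(1) by (auto simp: J_def)
    have "inj_on a J" unfolding J_def using I I' by (intro inj_on_Un[THEN iffD2]) auto
    then have JP: "J \<in> P_i G i"
      using I(1) I'(1) W aJ by (intro P_iI) (auto simp: a_def J_def Act_def)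
    \<comment> \<open>The cone coefficients sit on the active labels \<open>I\<close> and are zero
      on the added ones, so complementarity holds whatever the slacks on \<open>I'\<close>
      are.\<close>
    define l where "l = (\<chi> r. if r \<in> I then c (a r) else 0)"
    have l: "l \<in> coord_space J" by (simp add: l_def coord_space_def J_def)
    have "transpose (A_part G i J) *v l = (\<Sum>r\<in>I. c (a r) *\<^sub>R a r)"
      unfolding transpose_A_part_mult a_def[symmetric]
      by (rule sum.mono_neutral_cong_right) (auto simp: J_def l_def)
    also have "\<dots> = grad_i G i u" using I(2,3) V(4) by (simp add: sum.reindex)
    finally have grad: "grad_i G i u = transpose (A_part G i J) *v l" ..
    have sJ: "slack G i J (own G i u) (others G i u) $ r = (if r \<in> J then ?s i $ r else 0)" for r
      using P_i_independent(1)[OF JP] by (auto simp: slack_nth)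
    have "perp_nonneg l (slack G i J (own G i u) (others G i u))"
      unfolding perp_nonneg_def
    proof (intro conjI allI)
      show "0 \<le> l $ r" for r using V(3) I(3) by (auto simp: l_def)
      show "0 \<le> slack G i J (own G i u) (others G i u) $ r" for r
        using GNE_feasible[OF assms(1)] by (simp add: sJ feasible_def)
      show "l \<bullet> slack G i J (own G i u) (others G i u) = 0"
        unfolding inner_vec_def using I(1) by (intro sum.neutral) (auto simp: sJ l_def Act_def)
    qed
    \<comment> \<open>Uniqueness identifies \<open>l\<close> with the closed-form
      multiplier.\<close>
    then show ?thesis using JP grad lam_unique[OF JP l grad] by (intro exI[of _ J]) simp
  qed
  then obtain J where "\<And>i. J i \<in> P_i G i \<and>
      grad_i G i u - transpose (A_part G i (J i)) *v lam G i (J i) u = 0 \<and>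
      perp_nonneg (lam G i (J i) u) (slack G i (J i) (own G i u) (others G i u))"
    by metis
  then show ?thesis
    using GNE_feasible[OF assms(1)] by (intro bexI[of _ J]) (auto simp: K_J_def P_all_def)
qed

section \<open>Correctness and termination of the algorithms\<close>

text \<open>This is what the test in Step 4 decides. It ensures that the lower bound in Step 5 skips
  no point above \<open>u\<close>.\<close>

definition next_gap :: "('a \<Rightarrow> real) \<Rightarrow> 'a set \<Rightarrow> 'a \<Rightarrow> real \<Rightarrow> bool" where
  "next_gap f K u d \<longleftrightarrow> (\<forall>x\<in>K. f u < f x \<longrightarrow> f u + d < f x)"

text \<open>The number of halvings still ahead in the loop of Steps 3 and 4, used in the termination
  measure.\<close>

definition halvings :: "('a \<Rightarrow> real) \<Rightarrow> 'a set \<Rightarrow> 'a \<Rightarrow> real \<Rightarrow> nat" where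
  "halvings f K u d = (LEAST k. next_gap f K u (d / 2 ^ k))"

text \<open>The thresholds converge to \<open>f u\<close>, hence eventually fall below each of the
  finitely many larger values.\<close>

lemma ex_next_gap:
  assumes "finite K"
  shows "\<exists>k. next_gap f K u (d / 2 ^ k)"
proof -
  have "(\<lambda>k. d * (1 / 2) ^ k) \<longlonglongrightarrow> d * 0" by (intro tendsto_mult_left LIMSEQ_power_zero) simp
  then have lim: "(\<lambda>k. f u + d / 2 ^ k) \<longlonglongrightarrow> f u + 0"
    by (intro tendsto_add tendsto_const) (simp add: power_divide)
  have "\<forall>\<^sub>F k in sequentially. f u < f x \<longrightarrow> f u + d / 2 ^ k < f x" for x
    using order_tendstoD(2)[OF lim, of "f x"] by (cases "f u < f x") auto
  then have "\<forall>\<^sub>F k in sequentially. next_gap f K u (d / 2 ^ k)"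
    unfolding next_gap_def using assms by (simp add: eventually_ball_finite)
  then show ?thesis unfolding eventually_sequentially by blast
qed

lemma halvings_half:
  assumes "finite K" "\<not> next_gap f K u d"
  shows "halvings f K u d = Suc (halvings f K u (d / 2))"
proof -
  obtain k where "next_gap f K u (d / 2 ^ k)" using ex_next_gap[OF assms(1)] by blast
  moreover have "\<not> next_gap f K u (d / 2 ^ 0)" using assms(2) by simp
  ultimately have "(LEAST k. next_gap f K u (d / 2 ^ k)) = Suc (LEAST k. next_gap f K u (d / 2 ^ Suc k))"
    by (rule Least_Suc)
  then show ?thesis by (simp add: halvings_def mult.commute)
qed

text \<open>The inequality is strict at \<open>Step2\<close>, where \<open>u\<close> is still to be
  judged, and weak afterwards. Both final states carry the same condition, so that Algorithm B can
  treat them alike.\<close>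

fun inv_A :: "('p, 'n::finite, 'm::finite) gnep \<Rightarrow> real^'n option^'n option \<Rightarrow> (real^'n) set \<Rightarrow>
    'n state_A \<Rightarrow> bool" where
  "inv_A G T K (Step1 d S) \<longleftrightarrow> 0 < d \<and> S = {}"
| "inv_A G T K (Step2 u d S) \<longleftrightarrow> u \<in> K \<and> 0 < d \<and> S = {x \<in> K. GNE G x \<and> theta T x < theta T u}"
| "inv_A G T K (Step3 u d S) \<longleftrightarrow> u \<in> K \<and> 0 < d \<and> S = {x \<in> K. GNE G x \<and> theta T x \<le> theta T u}"
| "inv_A G T K (Step4 u d tmax S) \<longleftrightarrow> u \<in> K \<and> 0 < d \<and> S = {x \<in> K. GNE G x \<and> theta T x \<le> theta T u} \<and>
     (tmax = theta T u \<longleftrightarrow> next_gap (theta T) K u d)"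
| "inv_A G T K (Step5 u d S) \<longleftrightarrow> u \<in> K \<and> 0 < d \<and> S = {x \<in> K. GNE G x \<and> theta T x \<le> theta T u} \<and>
     next_gap (theta T) K u d"
| "inv_A G T K (Stop_No_GNE S) \<longleftrightarrow> S = {x \<in> K. GNE G x}"
| "inv_A G T K (Stop_All_GNEs S) \<longleftrightarrow> S = {x \<in> K. GNE G x}"

text \<open>First component of a lexicographic measure. Later states count points strictly above the
  current one, so the value at \<open>Step1\<close> exceeds all of them.\<close>

fun above_A :: "real^'n option^'n option \<Rightarrow> (real^'n) set \<Rightarrow> 'n::finite state_A \<Rightarrow> nat" where
  "above_A T K (Step1 d S) = Suc (card K)"
| "above_A T K (Step2 u d S) = card {x \<in> K. theta T u < theta T x}"
| "above_A T K (Step3 u d S) = card {x \<in> K. theta T u < theta T x}"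
| "above_A T K (Step4 u d tmax S) = card {x \<in> K. theta T u < theta T x}"
| "above_A T K (Step5 u d S) = card {x \<in> K. theta T u < theta T x}"
| "above_A T K _ = 0"

text \<open>Second component. A halving lowers \<open>halvings\<close> by one, so passing from
  \<open>Step4\<close> back to \<open>Step3\<close> goes from \<open>2 * h + 3\<close> to
  \<open>2 * h + 2\<close>, which explains the factor 2. Final states keep 1 to leave room for the
  return to Algorithm B.\<close>

fun phase_A :: "real^'n option^'n option \<Rightarrow> (real^'n) set \<Rightarrow> 'n::finite state_A \<Rightarrow> nat" where
  "phase_A T K (Step1 d S) = 0"
| "phase_A T K (Step2 u d S) = 2 * halvings (theta T) K u d + 5"
| "phase_A T K (Step3 u d S) = 2 * halvings (theta T) K u d + 4"
| "phase_A T K (Step4 u d tmax S) = 2 * halvings (theta T) K u d + 3"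
| "phase_A T K (Step5 u d S) = 2"
| "phase_A T K _ = 1"

fun is_final_A :: "'n::finite state_A \<Rightarrow> bool" where
  "is_final_A (Stop_No_GNE S) \<longleftrightarrow> True"
| "is_final_A (Stop_All_GNEs S) \<longleftrightarrow> True"
| "is_final_A _ \<longleftrightarrow> False"

lemma K_J_feasible: "x \<in> K_J G J \<Longrightarrow> x \<in> feasible G"
  by (simp add: K_J_def)

lemma step_A_inv:
  assumes "step_A G T J a a'" "inv_A G T (K_J G J) a" "inj_on (theta T) (K_J G J)"
  shows "inv_A G T (K_J G J) a'"
  using assms(1,2)
proof cases
  case (step1_infeasible d S)
  then show ?thesis using assms(2) by simp
next
  case (step1_min u d S)
  then show ?thesis using assms(2) by (auto simp: is_arg_min_def)
next
  case (step4_equal tmax u d S)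
  then show ?thesis using assms(2) by simp
next
  case (step4_halve tmax u d S)
  then show ?thesis using assms(2) by simp
next
  case (step2_accept u d S)
  then have "GNE G u" using assms(2) K_J_feasible eps_nonneg_iff_GNE[of u G] by auto
  \<comment> \<open>By injectivity \<open>u\<close> is the only point at its level, so it alone
    separates the strict from the weak inequality.\<close>
  then show ?thesis using step2_accept assms(2,3) by (auto dest: inj_onD simp: order_le_less)
next
  case (step2_reject u d S)
  then have "\<not> GNE G u" using assms(2) K_J_feasible eps_nonneg_iff_GNE[of u G] by auto
  then show ?thesis using step2_reject assms(2,3) by (auto dest: inj_onD simp: order_le_less)
next
  case (step3 u d y S)
  then have y: "y \<in> K_J G J" "theta T y \<le> theta T u + d"
    "\<And>x. x \<in> K_J G J \<Longrightarrow> theta T x \<le> theta T u + d \<Longrightarrow> theta T x \<le> theta T y"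
    by (auto simp: is_arg_max_def not_less)
  \<comment> \<open>As \<open>d\<close> is positive, \<open>u\<close> competes in the maximum;
    equality therefore means that no value lies above \<open>theta T u\<close> within
    \<open>d\<close>.\<close>
  then have "theta T u \<le> theta T y" using step3 assms(2) by auto
  then have "theta T y = theta T u \<longleftrightarrow> next_gap (theta T) (K_J G J) u d"
    using y unfolding next_gap_def by (metis linorder_not_le order.strict_iff_not order_antisym)
  then show ?thesis using step3 assms(2) by auto
next
  case (step5_infeasible u d S)
  \<comment> \<open>By the gap, any point above \<open>u\<close> would be feasible for Step 5, so
    \<open>u\<close> is at the top level.\<close>
  then have "theta T x \<le> theta T u" if "x \<in> K_J G J" for x
    using assms(2) that by (force simp: next_gap_def)
  then show ?thesis using step5_infeasible assms(2) by auto
next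
  case (step5_min u d u' S)
  then have u': "u' \<in> K_J G J" "theta T u + d \<le> theta T u'"
    "\<And>x. x \<in> K_J G J \<Longrightarrow> theta T u + d \<le> theta T x \<Longrightarrow> theta T u' \<le> theta T x"
    by (auto simp: is_arg_min_def not_less)
  \<comment> \<open>No level lies strictly between those of \<open>u\<close> and \<open>u'\<close>,
    so the weak bound at \<open>u\<close> becomes the strict bound at \<open>u'\<close>.\<close>
  have "theta T x \<le> theta T u \<longleftrightarrow> theta T x < theta T u'" if "x \<in> K_J G J" for x
    using u' that step5_min assms(2) by (force simp: next_gap_def)
  then show ?thesis using step5_min u' assms(2) by auto
qed

lemma step_A_measure:
  assumes "step_A G T J a a'" "inv_A G T (K_J G J) a" "finite (K_J G J)"
  shows "above_A T (K_J G J) a' < above_A T (K_J G J) a \<or>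
    above_A T (K_J G J) a' \<le> above_A T (K_J G J) a \<and> phase_A T (K_J G J) a' < phase_A T (K_J G J) a"
  using assms(1,2)
proof cases
  case (step1_min u d S)
  then show ?thesis using assms(3) by (auto simp: le_imp_less_Suc card_mono)
next
  case (step4_halve tmax u d S)
  \<comment> \<open>By the invariant, the failed test means that the gap condition fails, so a
    halving is still ahead.\<close>
  then show ?thesis using assms(2) halvings_half[OF assms(3)] by auto
next
  case (step5_min u d u' S)
  \<comment> \<open>Positivity of \<open>d\<close> puts \<open>u'\<close> strictly above
    \<open>u\<close>; it is counted before the step and not after.\<close>
  then have "theta T u < theta T u'" "u' \<in> K_J G J" using assms(2) by (auto simp: is_arg_min_def)
  then have "card {x \<in> K_J G J. theta T u' < theta T x} < card {x \<in> K_J G J. theta T u < theta T x}"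
    using assms(3) by (intro psubset_card_mono) auto
  then show ?thesis using step5_min by simp
qed simp_all

text \<open>Over a finite nonempty set every optimum is attained, and in \<open>Step3\<close> the
  point \<open>u\<close> itself keeps the set nonempty.\<close>

lemma step_A_progress:
  assumes "inv_A G T (K_J G J) a" "finite (K_J G J)" "\<not> is_final_A a"
  shows "\<exists>a'. step_A G T J a a'"
proof -
  have argmin: "\<exists>x. is_arg_min f (\<lambda>x. x \<in> A) x" if "finite A" "A \<noteq> {}" for f :: "real^'n \<Rightarrow> real" and A
    using ex_is_arg_min_if_finite[OF that] by blast
  show ?thesis
  proof (cases a)
    case (Step1 d S)
    then show ?thesis using argmin[OF assms(2)] step1_infeasible step1_min by metis
  next
    case (Step2 u d S)
    then show ?thesis using step2_accept step2_reject by metis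
  next
    case (Step3 u d S)
    let ?A = "{x \<in> K_J G J. theta T x \<le> theta T u + d}"
    have "\<exists>y. is_arg_min (\<lambda>x. - theta T x) (\<lambda>x. x \<in> ?A) y"
      using assms Step3 by (intro argmin) auto
    then have "\<exists>y. is_arg_max (theta T) (\<lambda>x. x \<in> K_J G J \<and> theta T x \<le> theta T u + d) y"
      by (simp add: is_arg_min_def is_arg_max_def)
    then show ?thesis using Step3 step3 by blast
  next
    case (Step4 u d tmax S)
    then show ?thesis using step4_equal step4_halve by metis
  next
    case (Step5 u d S)
    let ?A = "{x \<in> K_J G J. theta T u + d \<le> theta T x}"
    show ?thesis
    proof (cases "?A = {}")
      case True
      then show ?thesis using Step5 step5_infeasible by blast
    next
      case False
      then obtain u' where "is_arg_min (theta T) (\<lambda>x. x \<in> ?A) u'"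
        using argmin[of ?A] assms(2) by auto
      then show ?thesis using Step5 step5_min[of T G J u d u'] by auto
    qed
  qed (use assms(3) in simp_all)
qed

text \<open>The running tuple has left \<open>R\<close> but has not yet contributed to
  \<open>S\<close>, hence the extra removal of \<open>J\<close>.\<close>

fun inv_B :: "('p, 'n::finite, 'm::finite) gnep \<Rightarrow> real^'n option^'n option \<Rightarrow>
    ('p, 'n, 'm) state_B \<Rightarrow> bool" where
  "inv_B G T (Enum R S) \<longleftrightarrow> R \<subseteq> P_all G \<and> S = (\<Union>J\<in>P_all G - R. {x \<in> K_J G J. GNE G x})"
| "inv_B G T (Run_A R S J a) \<longleftrightarrow> R \<subseteq> P_all G \<and> J \<in> P_all G - R \<and>
     S = (\<Union>J\<in>P_all G - R - {J}. {x \<in> K_J G J. GNE G x}) \<and> inv_A G T (K_J G J) a"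

fun todo_B :: "('p, 'n::finite, 'm::finite) state_B \<Rightarrow> nat" where
  "todo_B (Enum R S) = card R"
| "todo_B (Run_A R S J a) = card R"

fun above_B :: "('p, 'n::finite, 'm::finite) gnep \<Rightarrow> real^'n option^'n option \<Rightarrow>
    ('p, 'n, 'm) state_B \<Rightarrow> nat" where
  "above_B G T (Enum R S) = 0"
| "above_B G T (Run_A R S J a) = above_A T (K_J G J) a"

fun phase_B :: "('p, 'n::finite, 'm::finite) gnep \<Rightarrow> real^'n option^'n option \<Rightarrow>
    ('p, 'n, 'm) state_B \<Rightarrow> nat" where
  "phase_B G T (Enum R S) = 0"
| "phase_B G T (Run_A R S J a) = phase_A T (K_J G J) a"

context
  fixes G :: "('p::finite, 'n::finite, 'm::finite) gnep" and T :: "real^'n option^'n option"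
  assumes fin: "\<And>J. J \<in> P_all G \<Longrightarrow> finite (K_J G J)"
    and inj: "\<And>J. J \<in> P_all G \<Longrightarrow> inj_on (theta T) (K_J G J)"
begin

lemma step_B_inv:
  assumes "step_B G T s s'" "inv_B G T s"
  shows "inv_B G T s'"
  using assms
proof cases
  case (call_A J R d S)
  then have "P_all G - (R - {J}) - {J} = P_all G - R" using assms(2) by auto
  then show ?thesis using call_A assms(2) by auto
next
  case (run_A J a a' R S)
  then show ?thesis using assms(2) step_A_inv[OF run_A(3)] inj by auto
next
  case (return_none R S J SJ)
  then show ?thesis using assms(2) by auto
next
  case (return_all R S J SJ)
  then show ?thesis using assms(2) by auto
qed

text \<open>A call shrinks the set of tuples left, a step of Algorithm A lowers its own measure, and
  a return lowers the phase from 1 to 0.\<close>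

lemma step_B_measure:
  assumes "step_B G T s s'" "inv_B G T s"
  shows "(s', s) \<in> measures [todo_B, above_B G T, phase_B G T]"
  using assms
proof cases
  case (call_A J R d S)
  then have "card (R - {J}) < card R" by (intro psubset_card_mono) auto
  then show ?thesis using call_A by simp
next
  case (run_A J a a' R S)
  then show ?thesis using assms(2) step_A_measure[OF run_A(3)] fin by auto
qed simp_all

lemma step_B_progress:
  assumes "inv_B G T s" "\<nexists>s'. step_B G T s s'"
  shows "\<exists>S. s = Enum {} S"
proof (cases s)
  case (Enum R S)
  have "R = {}"
  proof (rule ccontr)
    assume "R \<noteq> {}"
    then show False using assms(2) Enum call_A[of _ R 1 G T S] by auto
  qed
  then show ?thesis using Enum by simp
next
  case (Run_A R S J a)
  have "\<exists>s'. step_B G T s s'"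
  proof (cases "is_final_A a")
    case True
    then show ?thesis unfolding Run_A by (cases a) (auto intro: return_none return_all)
  next
    case False
    then obtain a' where "step_A G T J a a'"
      using Run_A step_A_progress[of G T J a] fin assms(1) by auto
    then show ?thesis unfolding Run_A by (intro exI) (rule run_A)
  qed
  then show ?thesis using assms(2) by blast
qed

lemma reachable_B_inv: "reachable_B G T s \<Longrightarrow> inv_B G T s"
  unfolding reachable_B_def
  by (induction rule: rtranclp_induct) (auto simp: init_B_def intro: step_B_inv)

lemma algorithm_B_terminates: "terminates_B G T"
  unfolding terminates_B_def
proof (intro conjI notI allI impI)
  assume "\<exists>\<sigma>. \<sigma> 0 = init_B G \<and> (\<forall>k::nat. step_B G T (\<sigma> k) (\<sigma> (Suc k)))"
  then obtain \<sigma> where \<sigma>: "\<sigma> 0 = init_B G" "\<And>k::nat. step_B G T (\<sigma> k) (\<sigma> (Suc k))" by blast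
  have "inv_B G T (\<sigma> k)" for k
    by (induction k) (auto simp: \<sigma>(1) init_B_def intro: step_B_inv \<sigma>(2))
  then have "\<forall>k. (\<sigma> (Suc k), \<sigma> k) \<in> measures [todo_B, above_B G T, phase_B G T]"
    using step_B_measure \<sigma>(2) by blast
  then show False
    using wf_measures[of "[todo_B, above_B G T, phase_B G T]"] unfolding wf_iff_no_infinite_down_chain by blast
next
  fix s assume "reachable_B G T s \<and> (\<nexists>s'. step_B G T s s')"
  then show "\<exists>S. s = Enum {} S" using reachable_B_inv step_B_progress by blast
qed

lemma algorithm_B_output: "outputs_B G T S \<Longrightarrow> S = (\<Union>J\<in>P_all G. {x \<in> K_J G J. GNE G x})"
  using reachable_B_inv[of "Enum {} S"] by (simp add: outputs_B_def)

end

theorem theorem4p6: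
  fixes G :: "('p::finite, 'n::finite, 'm::finite) gnep"
  assumes "\<And>i. real_polynomial_function (obj G i)"
    and "\<And>i r. r \<in> crows G i \<Longrightarrow> real_polynomial_function (\<lambda>w. bvec G i w $ r)"
    and "finite (KKT G)"
  shows "holds_generically (\<lambda>\<Theta> :: real^'n option^'n option. sym_pos_def \<Theta> \<longrightarrow>
           terminates_B G \<Theta> \<and>
           (\<forall>S. outputs_B G \<Theta> S \<longrightarrow>
              (S \<noteq> {} \<longrightarrow> S = {u. GNE G u}) \<and>
              (S = {} \<longrightarrow> \<not> (\<exists>u. GNE G u))))"
proof (rule holds_generically_mono[OF generically_inj_on_theta[OF assms(3)]])
  fix T :: "real^'n option^'n option"
  assume inj: "inj_on (theta T) (KKT G)"
  have fin_J: "finite (K_J G J)" and inj_J: "inj_on (theta T) (K_J G J)" if "J \<in> P_all G" for J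
    using K_J_subset_KKT[OF that] assms(3) inj by (auto intro: finite_subset inj_on_subset)
  \<comment> \<open>Polynomial objectives are differentiable, so each equilibrium lies in some
    \<open>K_J G J\<close>; the converse inclusion is built into the filter by
    \<open>GNE\<close>.\<close>
  have "(\<Union>J\<in>P_all G. {x \<in> K_J G J. GNE G x}) = {u. GNE G u}"
    using GNE_in_K_J[OF _ differentiable_at_real_polynomial_function[OF assms(1)]] by auto
  then have "outputs_B G T S \<Longrightarrow> S = {u. GNE G u}" for S
    using algorithm_B_output[OF fin_J inj_J] by simp
  then show "sym_pos_def T \<longrightarrow> terminates_B G T \<and>
       (\<forall>S. outputs_B G T S \<longrightarrow>
          (S \<noteq> {} \<longrightarrow> S = {u. GNE G u}) \<and> (S = {} \<longrightarrow> \<not> (\<exists>u. GNE G u)))"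
    using algorithm_B_terminates[OF fin_J inj_J] by auto
qed

end
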